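(* If $\mathsf{GP}(\mathsf{all})$ holds, then $\operatorname{cov}(\mathcal{M}) \ne \mathfrak{b}$.
   Context: $\mathsf{GP}(\mathsf{all})$: for every family $\langle A_x : x\in\omega^\omega\rangle$ of Lebesgue null subsets of $2^\omega$ with $x\le x'$ (pointwise) implying $A_x\subseteq A_{x'}$, the union $\bigcup_x A_x$ is Lebesgue null. $\mathcal{M}$ is the ideal of meager subsets of $2^\omega$ and $\operatorname{cov}(\mathcal{M})$ is the least size of a family of meager sets covering $2^\omega$. $\mathfrak{b}$ is the least size of a family $F\subseteq\omega^\omega$ with no $g$ satisfying $f\le^* g$ for all $f\in F$. *)

theory Defs
  imports "HOL-Probability.Probability"
begin

unbundle cardinal_syntax

section \<open>Null and meager subsets of the Cantor space\<close>

text \<open>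
  The Cantor space is the type \<^typ>\<open>nat \<Rightarrow> bool\<close>. Its topology is the product topology of the
  discrete space \<^typ>\<open>bool\<close> (the library instance for functions). Its Lebesgue measure is the
  product of the uniform measures on \<^typ>\<open>bool\<close>, completed, so that arbitrary
  subsets of Borel null sets are null.
\<close>

definition cantor_measure :: "(nat \<Rightarrow> bool) measure" where
  "cantor_measure = completion (Pi\<^sub>M UNIV (\<lambda>_. measure_pmf (bernoulli_pmf (1/2))))"

definition lebesgue_null :: "(nat \<Rightarrow> bool) set \<Rightarrow> bool" where
  "lebesgue_null A \<longleftrightarrow> A \<in> null_sets cantor_measure"

definition nowhere_dense :: "'a::topological_space set \<Rightarrow> bool" where
  "nowhere_dense A \<longleftrightarrow> interior (closure A) = {}"

definition meager :: "'a::topological_space set \<Rightarrow> bool" where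
  "meager A \<longleftrightarrow> (\<exists>N :: nat \<Rightarrow> 'a set. (\<forall>n. nowhere_dense (N n)) \<and> A = (\<Union>n. N n))"

section \<open>The principle \<open>GP(all)\<close>\<close>

text \<open>The order on \<^typ>\<open>nat \<Rightarrow> nat\<close> is the library's pointwise order.\<close>

definition GP_all :: bool where
  "GP_all \<longleftrightarrow>
    (\<forall>A :: (nat \<Rightarrow> nat) \<Rightarrow> (nat \<Rightarrow> bool) set.
      (\<forall>x. lebesgue_null (A x)) \<longrightarrow> (\<forall>x x'. x \<le> x' \<longrightarrow> A x \<subseteq> A x') \<longrightarrow>
      lebesgue_null (\<Union>x. A x))"

section \<open>Cardinal invariants\<close>

text \<open>
  The least cardinality of a set satisfying \<open>P\<close>, as a cardinal order in the sense of the library.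
  As for \<^const>\<open>cardSuc\<close>, the choice is unique only up to \<open>=o\<close>. Cardinal orders may live on
  different types, so cardinals are compared by \<open>=o\<close> and \<open>\<le>o\<close>.
\<close>

definition least_card :: "('a set \<Rightarrow> bool) \<Rightarrow> 'a rel" where
  "least_card P = (SOME r. \<exists>F. P F \<and> r = |F| \<and> (\<forall>G. P G \<longrightarrow> |F| \<le>o |G| ))"

lemma least_card_eq:
  assumes "P F0"
  shows "\<exists>F. P F \<and> least_card P = |F| \<and> (\<forall>G. P G \<longrightarrow> |F| \<le>o |G| )"
proof -
  have "\<exists>r\<in>card_of ` Collect P. \<forall>r'\<in>card_of ` Collect P. r \<le>o r'"
    using assms by (intro exists_minim_Card_order) (auto simp: card_of_Card_order)
  then have "\<exists>r. \<exists>F. P F \<and> r = |F| \<and> (\<forall>G. P G \<longrightarrow> |F| \<le>o |G| )"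
    by auto
  then show ?thesis
    unfolding least_card_def by (rule someI_ex)
qed

definition meager_cover :: "(nat \<Rightarrow> bool) set set \<Rightarrow> bool" where
  "meager_cover F \<longleftrightarrow> (\<forall>M\<in>F. meager M) \<and> \<Union>F = UNIV"

definition cov_meager :: "(nat \<Rightarrow> bool) set rel" where
  "cov_meager = least_card meager_cover"

definition eventually_le :: "(nat \<Rightarrow> nat) \<Rightarrow> (nat \<Rightarrow> nat) \<Rightarrow> bool"  (infix \<open>\<le>\<^sup>*\<close> 50) where
  "f \<le>\<^sup>* g \<longleftrightarrow> (\<forall>\<^sub>F n in sequentially. f n \<le> g n)"

definition unbounded_family :: "(nat \<Rightarrow> nat) set \<Rightarrow> bool" where
  "unbounded_family F \<longleftrightarrow> \<not> (\<exists>g. \<forall>f\<in>F. f \<le>\<^sup>* g)"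

definition bounding_number :: "(nat \<Rightarrow> nat) rel" where
  "bounding_number = least_card unbounded_family"

text \<open>Both minima are taken over nonempty collections.\<close>

lemma nowhere_dense_singleton: "nowhere_dense {x :: nat \<Rightarrow> bool}"
proof -
  have "\<not> open {x}"
  proof
    assume "open {x}"
    then obtain X where X: "x \<in> Pi\<^sub>E UNIV X" "finite {i. X i \<noteq> UNIV}" "Pi\<^sub>E UNIV X \<subseteq> {x}"
      using product_topology_open_contains_basis[of "\<lambda>_. euclidean" UNIV "{x}" x]
      by (auto simp: open_fun_def)
    obtain i where i: "X i = UNIV"
      using X(2) by (metis (mono_tags, lifting) UNIV_eq_I infinite_UNIV_nat mem_Collect_eq)
    have "x(i := \<not> x i) \<in> Pi\<^sub>E UNIV X"
      using X(1) i by (auto simp: PiE_iff)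
    then have "x(i := \<not> x i) = x"
      using X(3) by blast
    then show False
      by (metis fun_upd_same)
  qed
  moreover have "interior {x} = {} \<or> interior {x} = {x}"
    using interior_subset[of "{x}"] by blast
  ultimately have "interior {x} = {}"
    by (metis open_interior)
  moreover have "closed {x}"
  proof -
    have "closed ((\<lambda>f :: nat \<Rightarrow> bool. f i) -` {x i})" for i
      by (intro closed_vimage closed_singleton continuous_on_product_coordinates)
    then have "closed (\<Inter>i. (\<lambda>f :: nat \<Rightarrow> bool. f i) -` {x i})"
      by blast
    moreover have "(\<Inter>i. (\<lambda>f :: nat \<Rightarrow> bool. f i) -` {x i}) = {x}"
      by auto
    ultimately show ?thesis
      by simp
  qed
  ultimately show ?thesis
    by (simp add: nowhere_dense_def)
qed

lemma meager_cover_exists: "meager_cover (range (\<lambda>x. {x}))"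
  unfolding meager_cover_def meager_def using nowhere_dense_singleton by fastforce

lemma unbounded_family_UNIV: "unbounded_family UNIV"
  unfolding unbounded_family_def
proof
  assume "\<exists>g. \<forall>f\<in>UNIV. f \<le>\<^sup>* g"
  then obtain g where "(\<lambda>n. Suc (g n)) \<le>\<^sup>* g"
    by blast
  then show False
    by (simp add: eventually_le_def)
qed

end

theory Submission
  imports Defs
begin

text \<open>
  For a strictly increasing \<open>h\<close>, the points of the Cantor space that vanish at almost all
  coordinates in the range of \<open>h\<close> form a null set. Fewer than \<open>cov(M)\<close> such sets have a null union,
  since a point avoiding fewer than \<open>cov(M)\<close> meager sets guesses a long piece of every \<open>h\<close> infinitely
  often. On the other hand, some \<open>cov(M)\<close> such sets do not have a null union: otherwise all these
  sets could be kept away from a closed set of positive measure, whose tree bounds the number of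
  candidates for the next value of \<open>h\<close>; these guesses produce a point outside every member
  of a given cover by meager sets. If \<open>cov(M) = b\<close>, list these sets as \<open>E f\<close> for \<open>f\<close> in a well-ordered
  unbounded family of size \<open>b\<close>, and let \<open>A x\<close> be the union of those \<open>E f\<close> for which \<open>x\<close> dominates
  all predecessors of \<open>f\<close> and \<open>f\<close> itself. As \<open>x\<close> dominates only a proper initial segment, each \<open>A x\<close> is
  null, and the \<open>A x\<close> contradict \<open>GP(all)\<close>.
\<close>

section \<open>The coin-tossing measure\<close>

abbreviation coin_space :: "(nat \<Rightarrow> bool) measure" where
  "coin_space \<equiv> Pi\<^sub>M UNIV (\<lambda>_. measure_pmf (bernoulli_pmf (1/2)))"

interpretation coin: product_prob_space "\<lambda>_::nat. measure_pmf (bernoulli_pmf (1/2))" UNIV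
  by unfold_locales

lemma space_coin [simp]: "space coin_space = UNIV"
  by (simp add: space_PiM)

lemma lebesgue_null_iff: "lebesgue_null A \<longleftrightarrow> (\<exists>N\<in>null_sets coin_space. A \<subseteq> N)"
  by (simp add: lebesgue_null_def cantor_measure_def null_sets_completion_iff2)

lemma lebesgue_null_subset: "lebesgue_null B \<Longrightarrow> A \<subseteq> B \<Longrightarrow> lebesgue_null A"
  unfolding lebesgue_null_iff by blast

lemma sets_coin_coordinate [measurable]: "{w. w q = v} \<in> sets coin_space"
proof -
  have "(\<lambda>w. w q) -` {v} \<inter> space coin_space \<in> sets coin_space"
    by (rule measurable_sets[OF measurable_component_singleton]) auto
  then show ?thesis by (simp add: vimage_def)
qed

lemma measure_coin_prescribed:
  assumes "finite F"
  shows "measure coin_space {w. \<forall>q\<in>F. w q = v q} = (1/2) ^ card F"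
proof -
  have "emeasure coin_space {w \<in> space coin_space. \<forall>q\<in>F. w q \<in> {v q}}
    = (\<Prod>q\<in>F. emeasure (measure_pmf (bernoulli_pmf (1/2))) {v q})"
    by (rule coin.emeasure_PiM_Collect) (use assms in auto)
  moreover have "emeasure (measure_pmf (bernoulli_pmf (1/2))) {b} = ennreal (1/2)" for b
    by (cases b) (simp_all add: emeasure_pmf_single)
  ultimately have "emeasure coin_space {w. \<forall>q\<in>F. w q = v q} = ennreal ((1/2) ^ card F)"
    by (simp del: ennreal_half add: ennreal_power)
  then show ?thesis
    by (simp add: measure_def)
qed

lemma sets_coin_prescribed [measurable]:
  assumes "finite F"
  shows "{w. \<forall>q\<in>F. w q = v q} \<in> sets coin_space"
proof -
  have "{w \<in> space coin_space. \<forall>q\<in>F. w q = v q} \<in> sets coin_space"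
    by (rule sets.sets_Collect_finite_All[OF _ assms]) simp
  then show ?thesis by simp
qed

text \<open>Outer regularity is only available for complete metric spaces, so the measure is
  pushed forward along the embedding of the Cantor space into the sequences of reals.\<close>

lemma null_open_superset:
  assumes "lebesgue_null N" and "0 < e"
  obtains U where "open U" "N \<subseteq> U" "U \<in> sets coin_space" "measure coin_space U < e"
proof -
  define emb :: "(nat \<Rightarrow> bool) \<Rightarrow> nat \<Rightarrow> real" where "emb w n = of_bool (w n)" for w n
  define P where "P = distr coin_space borel emb"
  obtain B where B: "B \<in> null_sets coin_space" "N \<subseteq> B"
    using assms by (auto simp: lebesgue_null_iff)
  have "(\<lambda>w. emb w n) \<in> borel_measurable coin_space" for n
    unfolding emb_def by (rule measurable_compose[OF measurable_component_singleton]) auto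
  then have "emb \<in> measurable coin_space (Pi\<^sub>M UNIV (\<lambda>_. borel))"
    by (intro measurable_PiM_single') auto
  then have emb: "emb \<in> measurable coin_space borel"
    by (simp cong: measurable_cong_sets add: sets_PiM_equal_borel)
  \<comment> \<open>\<open>ret\<close> is a measurable left inverse of \<open>emb\<close>; it turns
    the null set \<open>B\<close> into the preimage under \<open>emb\<close> of a Borel set
    \<open>C\<close> of \<open>P\<close>-measure zero.\<close>
  define ret :: "(nat \<Rightarrow> real) \<Rightarrow> nat \<Rightarrow> bool" where "ret f n \<longleftrightarrow> f n = 1" for f n
  have "(\<lambda>f. ret f n) \<in> measurable (Pi\<^sub>M UNIV (\<lambda>_. borel)) (measure_pmf (bernoulli_pmf (1/2)))" for n
    unfolding ret_def by simp
  then have "ret \<in> measurable (Pi\<^sub>M UNIV (\<lambda>_. borel)) coin_space"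
    by (intro measurable_PiM_single') auto
  then have ret: "ret \<in> measurable borel coin_space"
    by (simp cong: measurable_cong_sets add: sets_PiM_equal_borel)
  have re: "ret (emb w) = w" for w
    by (auto simp: ret_def emb_def)
  define C where "C = ret -` B"
  have C: "C \<in> sets borel"
    using measurable_sets[OF ret, of B] B by (auto simp: C_def null_sets_def)
  have "emb -` C = B"
    by (auto simp: C_def re)
  then have PC: "emeasure P C = 0"
    using B C emb by (simp add: P_def emeasure_distr null_sets_def)
  have fin: "emeasure P (space P) \<noteq> \<infinity>"
    using emb by (simp add: P_def emeasure_distr coin.emeasure_space_1[simplified])
  have "emeasure P C = (INF U \<in> {U. C \<subseteq> U \<and> open U}. emeasure P U)"
    by (rule outer_regular) (use C fin in \<open>auto simp: P_def\<close>)
  then have "(INF U \<in> {U. C \<subseteq> U \<and> open U}. emeasure P U) < ennreal e"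
    using PC assms(2) by simp
  then obtain U where U: "C \<subseteq> U" "open U" "emeasure P U < ennreal e"
    unfolding INF_less_iff by auto
  have cont: "continuous_on UNIV emb"
  proof (rule continuous_on_coordinatewise_then_product)
    fix n
    have "continuous_on UNIV (of_bool :: bool \<Rightarrow> real)"
      by simp
    from continuous_on_compose2[OF this continuous_on_product_coordinates[of n]]
    show "continuous_on UNIV (\<lambda>w. emb w n)"
      unfolding emb_def by simp
  qed
  show thesis
  proof (rule that)
    show "open (emb -` U)"
      using cont U(2) by (rule open_vimage[rotated])
    show "N \<subseteq> emb -` U"
      using B U \<open>emb -` C = B\<close> by blast
    show "emb -` U \<in> sets coin_space"
      using measurable_sets[OF emb, of U] U(2) by simp
    have "emeasure coin_space (emb -` U) < ennreal e"
      using U emb by (simp add: P_def emeasure_distr)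
    then show "measure coin_space (emb -` U) < e"
      by (simp add: coin.emeasure_eq_measure ennreal_less_iff)
  qed
qed

text \<open>A basic open set of the product restricts only finitely many coordinates, all below some
  \<open>m\<close>.\<close>

lemma open_cantor_iff:
  fixes U :: "(nat \<Rightarrow> bool) set"
  shows "open U \<longleftrightarrow> (\<forall>w\<in>U. \<exists>m. \<forall>w'. (\<forall>i<m. w' i = w i) \<longrightarrow> w' \<in> U)"
proof safe
  fix w assume "open U" "w \<in> U"
  then obtain X where X: "w \<in> Pi\<^sub>E UNIV X" "finite {i. X i \<noteq> UNIV}" "Pi\<^sub>E UNIV X \<subseteq> U"
    using product_topology_open_contains_basis[of "\<lambda>_. euclidean" UNIV U w]
    by (auto simp: open_fun_def)
  obtain m where m: "{i. X i \<noteq> UNIV} \<subseteq> {..<m}"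
    using finite_nat_bounded[OF X(2)] by blast
  have "w' \<in> U" if "\<forall>i<m. w' i = w i" for w'
  proof -
    have "w' i \<in> X i" for i
      using that m X(1) by (cases "i < m") (auto simp: PiE_iff)
    then show ?thesis using X(3) by (auto simp: PiE_iff)
  qed
  then show "\<exists>m. \<forall>w'. (\<forall>i<m. w' i = w i) \<longrightarrow> w' \<in> U" by blast
next
  assume *: "\<forall>w\<in>U. \<exists>m. \<forall>w'. (\<forall>i<m. w' i = w i) \<longrightarrow> w' \<in> U"
  show "open U"
  proof (subst open_subopen, safe)
    fix w assume "w \<in> U"
    with * obtain m where m: "\<And>w'. (\<forall>i<m. w' i = w i) \<Longrightarrow> w' \<in> U" by blast
    have "open ((\<lambda>v :: nat \<Rightarrow> bool. v i) -` {w i})" for i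
      by (intro open_vimage discrete_topology_class.open_discrete continuous_on_product_coordinates)
    then have "open (\<Inter>i\<in>{..<m}. (\<lambda>v :: nat \<Rightarrow> bool. v i) -` {w i})"
      by (intro open_INT) auto
    with m show "\<exists>T. open T \<and> w \<in> T \<and> T \<subseteq> U"
      by (intro exI[of _ "\<Inter>i\<in>{..<m}. (\<lambda>v :: nat \<Rightarrow> bool. v i) -` {w i}"]) auto
  qed
qed

section \<open>A slalom from a closed set of positive measure\<close>

definition eventually_off :: "(nat \<Rightarrow> nat) \<Rightarrow> (nat \<Rightarrow> bool) set" where
  "eventually_off h = {w. \<forall>\<^sub>F n in sequentially. \<not> w (h n)}"

text \<open>The bound is inclusive: a cylinder of level \<open>q\<close> decides the coordinate
  \<open>q\<close> itself, which \<open>forced\<close> inspects.\<close>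

definition cyl :: "(nat \<Rightarrow> bool) \<Rightarrow> nat \<Rightarrow> (nat \<Rightarrow> bool) set" where
  "cyl s m = {w. \<forall>i\<le>m. w i = s i}"

text \<open>Padding with \<open>False\<close> picks one canonical point in each cylinder of level
  \<open>m\<close>, so that finitely many indices suffice.\<close>

definition trunc :: "nat \<Rightarrow> (nat \<Rightarrow> bool) \<Rightarrow> nat \<Rightarrow> bool" where
  "trunc m w i \<longleftrightarrow> i \<le> m \<and> w i"

definition truncs :: "nat \<Rightarrow> (nat \<Rightarrow> bool) set" where
  "truncs m = range (trunc m)"

lemma cyl_self [simp]: "s \<in> cyl s m"
  by (simp add: cyl_def)

lemma cyl_trunc [simp]: "cyl (trunc m w) m = cyl w m"
  by (auto simp: cyl_def trunc_def)

lemma sets_cyl [measurable]: "cyl s m \<in> sets coin_space"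
proof -
  have "cyl s m = {w. \<forall>q\<in>{..m}. w q = s q}"
    by (auto simp: cyl_def)
  then show ?thesis
    using sets_coin_prescribed[of "{..m}" s] by simp
qed

lemma finite_truncs: "finite (truncs m)" and card_truncs: "card (truncs m) \<le> 2 ^ Suc m"
proof -
  have "trunc m w \<in> (\<lambda>A i. i \<in> A) ` Pow {..m}" for w
    by (rule image_eqI[of _ _ "{i. i \<le> m \<and> w i}"]) (auto simp: trunc_def)
  then have sub: "truncs m \<subseteq> (\<lambda>A i. i \<in> A) ` Pow {..m}"
    by (auto simp: truncs_def)
  then show "finite (truncs m)"
    by (rule finite_subset) simp
  have "card (truncs m) \<le> card ((\<lambda>A i. i \<in> A) ` Pow {..m})"
    by (rule card_mono[OF _ sub]) simp
  also have "\<dots> \<le> card (Pow {..m})"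
    by (rule card_image_le) simp
  finally show "card (truncs m) \<le> 2 ^ Suc m"
    by (simp add: card_Pow)
qed

text \<open>A union of at most \<open>2^(q + 1)\<close> pieces of size \<open>threshold q\<close> must be negligible against
  \<open>threshold m\<close> for all \<open>q > m\<close> together, which is why the exponent is quadratic.\<close>

definition threshold :: "nat \<Rightarrow> real" where
  "threshold m = (1/2) ^ (m + 2)\<^sup>2"

lemma threshold_pos: "0 < threshold m"
  by (simp add: threshold_def)

text \<open>The squares in the exponents lie far enough apart to absorb the factor
  \<open>2 ^ Suc q\<close> and leave a geometric factor, which makes the bounds summable over
  \<open>q\<close>.\<close>

lemma threshold_step:
  assumes "m < q"
  shows "2 ^ Suc q * threshold q \<le> threshold m / 2 * (1/2) ^ (q - m)"
proof -
  obtain d where q: "q = m + 1 + d"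
    using assms less_iff_Suc_add by auto
  have "Suc q + ((m + 2)\<^sup>2 + 1 + (q - m)) \<le> (q + 2)\<^sup>2"
    unfolding q by (simp add: power2_eq_square algebra_simps)
  then have "(1/2 :: real) ^ (q + 2)\<^sup>2 \<le> (1/2) ^ (Suc q + ((m + 2)\<^sup>2 + 1 + (q - m)))"
    by (intro power_decreasing) auto
  then have "2 ^ Suc q * threshold q \<le> 2 ^ Suc q * (1/2) ^ (Suc q + ((m + 2)\<^sup>2 + 1 + (q - m)))"
    unfolding threshold_def by (intro mult_left_mono) auto
  also have "\<dots> = threshold m / 2 * (1/2) ^ (q - m)"
    unfolding threshold_def power_add by (simp add: power_one_over)
  finally show ?thesis .
qed

lemma sum_threshold:
  assumes "finite F" "F \<subseteq> {m<..}"
  shows "(\<Sum>q\<in>F. 2 ^ Suc q * threshold q) \<le> threshold m / 2"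
proof -
  have "(\<Sum>q\<in>F. (1/2 :: real) ^ (q - m)) = (\<Sum>n\<in>(\<lambda>q. q - Suc m) ` F. (1/2) ^ Suc n)"
  proof (subst sum.reindex)
    show "inj_on (\<lambda>q. q - Suc m) F"
      using assms(2) by (intro inj_on_diff_nat) auto
    have "q - m = Suc (q - Suc m)" if "q \<in> F" for q
      using assms(2) that by auto
    then show "(\<Sum>q\<in>F. (1/2 :: real) ^ (q - m)) = sum ((\<lambda>n. (1/2) ^ Suc n) \<circ> (\<lambda>q. q - Suc m)) F"
      by (intro sum.cong) auto
  qed
  also have "\<dots> \<le> (\<Sum>n. (1/2) ^ Suc n)"
    using assms(1) sums_summable[OF power_half_series] by (intro sum_le_suminf) auto
  also have "\<dots> = 1"
    using power_half_series by (rule sums_unique[symmetric])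
  finally have *: "(\<Sum>q\<in>F. (1/2 :: real) ^ (q - m)) \<le> 1" .
  have "(\<Sum>q\<in>F. 2 ^ Suc q * threshold q) \<le> (\<Sum>q\<in>F. threshold m / 2 * (1/2) ^ (q - m))"
    using assms by (intro sum_mono threshold_step) auto
  also have "\<dots> = threshold m / 2 * (\<Sum>q\<in>F. (1/2) ^ (q - m))"
    by (simp add: sum_distrib_left)
  also have "\<dots> \<le> threshold m / 2 * 1"
    using * threshold_pos[of m] by (intro mult_left_mono) auto
  finally show ?thesis by simp
qed

text \<open>A quantitative form of meeting \<open>K\<close>: a heavy cylinder meets
  \<open>K\<close>, while the light cylinders of each level capture only a summably small part of
  \<open>K\<close>.\<close>

definition heavy :: "(nat \<Rightarrow> bool) set \<Rightarrow> (nat \<Rightarrow> bool) \<Rightarrow> nat \<Rightarrow> bool" where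
  "heavy K s m \<longleftrightarrow> threshold m \<le> measure coin_space (cyl s m \<inter> K)"

text \<open>These are the obstructions to the path built in \<open>slalom_captures\<close>: for any
  other \<open>q\<close> above \<open>m\<close>, some heavy cylinder of level \<open>q\<close>
  inside \<open>cyl s m\<close> vanishes at \<open>q\<close>.\<close>

definition forced :: "(nat \<Rightarrow> bool) set \<Rightarrow> (nat \<Rightarrow> bool) \<Rightarrow> nat \<Rightarrow> nat set" where
  "forced K s m = {q. m < q \<and> (\<forall>s'\<in>cyl s m. heavy K s' q \<longrightarrow> s' q)}"

text \<open>At most \<open>2 ^ Suc q\<close> cylinders of level \<open>q\<close> are light, and each
  meets \<open>K\<close> in measure below \<open>threshold q\<close>.\<close>

lemma measure_light_cover:
  assumes "K \<in> sets coin_space" "A \<in> sets coin_space" "A \<subseteq> K"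
    and light: "\<And>w. w \<in> A \<Longrightarrow> \<not> heavy K w q"
  shows "measure coin_space A \<le> 2 ^ Suc q * threshold q"
proof -
  define T where "T = {s \<in> truncs q. \<not> heavy K s q}"
  have T: "finite T" "card T \<le> 2 ^ Suc q"
    using finite_truncs[of q] card_truncs[of q] card_mono[OF finite_truncs, of T q]
    by (auto simp: T_def)
  have "A \<subseteq> (\<Union>s\<in>T. cyl s q \<inter> K)"
  proof
    fix w assume w: "w \<in> A"
    have "trunc q w \<in> T"
      using light[OF w] by (simp add: T_def truncs_def heavy_def)
    moreover have "w \<in> cyl (trunc q w) q"
      by simp
    ultimately show "w \<in> (\<Union>s\<in>T. cyl s q \<inter> K)"
      using w assms(3) by blast
  qed
  then have "measure coin_space A \<le> measure coin_space (\<Union>s\<in>T. cyl s q \<inter> K)"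
    using T assms by (intro coin.finite_measure_mono) auto
  also have "\<dots> \<le> (\<Sum>s\<in>T. measure coin_space (cyl s q \<inter> K))"
    using T assms by (intro coin.finite_measure_subadditive_finite) auto
  also have "\<dots> \<le> (\<Sum>s\<in>T. threshold q)"
    by (intro sum_mono) (auto simp: T_def heavy_def)
  also have "\<dots> = card T * threshold q"
    by simp
  also have "\<dots> \<le> 2 ^ Suc q * threshold q"
  proof (rule mult_right_mono)
    have "real (card T) \<le> real (2 ^ Suc q)" using T(2) by (rule of_nat_mono)
    then show "real (card T) \<le> 2 ^ Suc q" by simp
  qed (use threshold_pos[of q] in simp)
  finally show ?thesis .
qed

lemma heavy_exists:
  assumes "K \<in> sets coin_space" "1/2 < measure coin_space K"
  shows "\<exists>s. heavy K s m"
proof (rule ccontr)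
  assume "\<not> ?thesis"
  then have "measure coin_space K \<le> 2 ^ Suc m * threshold m"
    using assms by (intro measure_light_cover) auto
  also have "\<dots> \<le> 2 ^ Suc m * (1/2) ^ (Suc m + 1)"
    unfolding threshold_def
    by (intro mult_left_mono power_decreasing) (auto simp: power2_eq_square)
  also have "\<dots> = 1/2"
    by (simp add: power_one_over)
  finally show False using assms(2) by simp
qed

text \<open>The points of the heavy piece that vanish somewhere on \<open>F\<close> use up at most
  half of \<open>threshold m\<close>. The other points are true on all of \<open>F\<close>, a set of
  measure \<open>(1/2) ^ card F\<close>, which must account for the other half.\<close>

lemma card_subset_forced:
  assumes K: "K \<in> sets coin_space" and heavy: "heavy K s m" and F: "finite F" "F \<subseteq> forced K s m"
  shows "card F \<le> (m + 2)\<^sup>2 + 1"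
proof -
  define Z where "Z q = cyl s m \<inter> K \<inter> {w. w q = False}" for q
  have Z: "Z q \<in> sets coin_space" for q
    using K by (auto simp: Z_def)
  \<comment> \<open>A point of \<open>Z q\<close> vanishes at the forced coordinate
    \<open>q\<close>, so its cylinder of level \<open>q\<close> is light.\<close>
  have "measure coin_space (Z q) \<le> 2 ^ Suc q * threshold q" if "q \<in> F" for q
    using that F K Z by (intro measure_light_cover) (auto simp: Z_def forced_def)
  then have "(\<Sum>q\<in>F. measure coin_space (Z q)) \<le> (\<Sum>q\<in>F. 2 ^ Suc q * threshold q)"
    by (rule sum_mono)
  also have "F \<subseteq> {m<..}"
    using F(2) by (auto simp: forced_def)
  with F(1) have "(\<Sum>q\<in>F. 2 ^ Suc q * threshold q) \<le> threshold m / 2"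
    by (rule sum_threshold)
  finally have sumZ: "(\<Sum>q\<in>F. measure coin_space (Z q)) \<le> threshold m / 2" .
  have "cyl s m \<inter> K \<subseteq> {w. \<forall>q\<in>F. w q = True} \<union> (\<Union>q\<in>F. Z q)"
    by (auto simp: Z_def)
  then have "measure coin_space (cyl s m \<inter> K)
      \<le> measure coin_space ({w. \<forall>q\<in>F. w q = True} \<union> (\<Union>q\<in>F. Z q))"
    using F(1) Z by (intro coin.finite_measure_mono sets.Un sets.finite_UN sets_coin_prescribed) auto
  also have "\<dots> \<le> measure coin_space {w. \<forall>q\<in>F. w q = True} + measure coin_space (\<Union>q\<in>F. Z q)"
    using F(1) Z by (intro measure_Un_le sets.finite_UN sets_coin_prescribed) auto
  also have "\<dots> \<le> (1/2) ^ card F + (\<Sum>q\<in>F. measure coin_space (Z q))"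
    unfolding measure_coin_prescribed[OF F(1)]
    using F(1) Z by (intro add_left_mono coin.finite_measure_subadditive_finite) auto
  also have "\<dots> \<le> (1/2) ^ card F + threshold m / 2"
    using sumZ by simp
  finally have "threshold m / 2 \<le> (1/2) ^ card F"
    using heavy unfolding heavy_def by linarith
  moreover have "threshold m / 2 = (1/2) ^ ((m + 2)\<^sup>2 + 1)"
    unfolding threshold_def power_add by simp
  ultimately have le: "(1/2 :: real) ^ ((m + 2)\<^sup>2 + 1) \<le> (1/2) ^ card F"
    by simp
  show ?thesis
    by (rule iffD1[OF power_decreasing_iff le]) auto
qed

text \<open>The number of cylinders of level \<open>m\<close> times the bound of
  \<open>card_subset_forced\<close>. It does not depend on \<open>K\<close>.\<close>

definition slalom_width :: "nat \<Rightarrow> nat" where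
  "slalom_width m = 2 ^ Suc m * ((m + 2)\<^sup>2 + 1)"

definition slalom :: "(nat \<Rightarrow> bool) set \<Rightarrow> nat \<Rightarrow> nat set" where
  "slalom K m = (\<Union>s\<in>{s \<in> truncs m. heavy K s m}. forced K s m)"

lemma finite_slalom: "K \<in> sets coin_space \<Longrightarrow> finite (slalom K m)"
  and card_slalom: "K \<in> sets coin_space \<Longrightarrow> card (slalom K m) \<le> slalom_width m"
proof -
  assume K: "K \<in> sets coin_space"
  let ?T = "{s \<in> truncs m. heavy K s m}"
  have T: "finite ?T" "card ?T \<le> 2 ^ Suc m"
    using finite_truncs[of m] card_truncs[of m] card_mono[OF finite_truncs, of ?T m] by auto
  have fin: "finite (forced K s m)" and card: "card (forced K s m) \<le> (m + 2)\<^sup>2 + 1" if "s \<in> ?T" for s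
  proof -
    show "finite (forced K s m)"
    proof (rule ccontr)
      assume "infinite (forced K s m)"
      then obtain F where "F \<subseteq> forced K s m" "finite F" "card F = (m + 2)\<^sup>2 + 2"
        using infinite_arbitrarily_large by blast
      then show False
        using card_subset_forced[OF K, of s m F] that by simp
    qed
    then show "card (forced K s m) \<le> (m + 2)\<^sup>2 + 1"
      using card_subset_forced[OF K, of s m] that by simp
  qed
  show "finite (slalom K m)"
    using T fin by (auto simp: slalom_def)
  have "card (slalom K m) \<le> (\<Sum>s\<in>?T. card (forced K s m))"
    unfolding slalom_def using T by (intro card_UN_le) auto
  also have "\<dots> \<le> card ?T * ((m + 2)\<^sup>2 + 1)"
    using sum_bounded_above[of ?T "\<lambda>s. card (forced K s m)" "(m + 2)\<^sup>2 + 1"] card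
    by (simp only: of_nat_id)
  also have "\<dots> \<le> slalom_width m"
    unfolding slalom_width_def using T by (intro mult_right_mono) auto
  finally show "card (slalom K m) \<le> slalom_width m" .
qed

text \<open>If \<open>h\<close> escaped the slalom from some point on, a path of heavy cylinders vanishing along \<open>h\<close>
  would converge to a point of the closed set \<open>- U\<close>.\<close>

lemma slalom_captures:
  assumes U: "open U" "U \<in> sets coin_space" "measure coin_space U < 1/2"
    and h: "strict_mono h" "eventually_off h \<subseteq> U"
  shows "\<exists>\<^sub>F k in sequentially. h (Suc k) \<in> slalom (- U) (h k)"
proof (rule ccontr)
  assume "\<not> ?thesis"
  then obtain k0 where k0: "\<And>k. k \<ge> k0 \<Longrightarrow> h (Suc k) \<notin> slalom (- U) (h k)"
    by (auto simp: not_frequently eventually_sequentially)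
  have K: "- U \<in> sets coin_space"
    using sets.compl_sets[OF U(2)] by (simp add: Compl_eq_Diff_UNIV)
  have "measure coin_space (- U) = 1 - measure coin_space U"
    using coin.prob_compl[OF U(2)] by (simp add: Compl_eq_Diff_UNIV)
  then have "1/2 < measure coin_space (- U)"
    using U(3) by simp
  note start = heavy_exists[OF K this]
  have step: "\<exists>s'. heavy (- U) s' (h (k0 + Suc n)) \<and>
      (s' \<in> cyl s (h (k0 + n)) \<and> \<not> s' (h (k0 + Suc n)))"
    if "heavy (- U) s (h (k0 + n))" for s n
  proof -
    have "h (k0 + Suc n) \<notin> slalom (- U) (h (k0 + n))"
      using k0[of "k0 + n"] by simp
    moreover have "heavy (- U) (trunc (h (k0 + n)) s) (h (k0 + n))"
      using that by (simp add: heavy_def)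
    ultimately have "h (k0 + Suc n) \<notin> forced (- U) (trunc (h (k0 + n)) s) (h (k0 + n))"
      by (auto simp: slalom_def truncs_def)
    moreover have "h (k0 + n) < h (k0 + Suc n)"
      using h(1) by (simp add: strict_mono_def)
    ultimately show ?thesis
      by (auto simp: forced_def)
  qed
  have "\<exists>s. \<forall>n. heavy (- U) (s n) (h (k0 + n)) \<and>
      (s (Suc n) \<in> cyl (s n) (h (k0 + n)) \<and> \<not> s (Suc n) (h (k0 + Suc n)))"
    using start step by (intro dependent_nat_choice) auto
  then obtain s where s: "\<And>n. heavy (- U) (s n) (h (k0 + n))"
    "\<And>n. s (Suc n) \<in> cyl (s n) (h (k0 + n))" "\<And>n. \<not> s (Suc n) (h (k0 + Suc n))"
    by auto
  have coherent: "s (n + d) i = s n i" if "i \<le> h (k0 + n)" for n d i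
  proof (induction d)
    case (Suc d)
    have "h (k0 + n) \<le> h (k0 + (n + d))"
      using h(1) by (simp add: strict_mono_less_eq)
    then show ?case
      using s(2)[of "n + d"] Suc that by (simp add: cyl_def)
  qed simp
  \<comment> \<open>As \<open>i <= h (k0 + i)\<close>, coordinate \<open>i\<close> is settled from
    stage \<open>i\<close> on, so the diagonal is the limit of the path.\<close>
  define w where "w i = s i i" for i
  have w: "w i = s n i" if "i \<le> h (k0 + n)" for i n
  proof (cases "i \<le> n")
    case True
    have "i \<le> h (k0 + i)"
      using strict_mono_imp_increasing[OF h(1), of "k0 + i"] by simp
    then show ?thesis
      using coherent[of i i "n - i"] True by (simp add: w_def)
  next
    case False
    then show ?thesis
      using coherent[OF that, of "i - n"] by (simp add: w_def)
  qed
  have "\<not> w (h k)" if k: "Suc k0 \<le> k" for k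
  proof -
    obtain n where "k = k0 + Suc n"
      using le_Suc_ex[OF k] by auto
    then show ?thesis
      using w[of "h k" "Suc n"] s(3)[of n] by simp
  qed
  then have "w \<in> U"
    using h(2) unfolding eventually_off_def eventually_sequentially by blast
  \<comment> \<open>Openness puts a whole heavy cylinder of the path inside \<open>U\<close>,
    although it meets \<open>- U\<close> in positive measure.\<close>
  then obtain m where m: "\<And>w'. (\<forall>i<m. w' i = w i) \<Longrightarrow> w' \<in> U"
    using U(1) unfolding open_cantor_iff by blast
  have "m \<le> h (k0 + m)"
    using strict_mono_imp_increasing[OF h(1), of "k0 + m"] by simp
  then have "w i = s m i" if "i < m" for i
    using w that by auto
  with \<open>m \<le> h (k0 + m)\<close> have "cyl (s m) (h (k0 + m)) \<subseteq> U"
    by (auto simp: cyl_def intro!: m)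
  then have "cyl (s m) (h (k0 + m)) \<inter> - U = {}"
    by blast
  then show False
    using s(1)[of m] threshold_pos[of "h (k0 + m)"] by (simp add: heavy_def)
qed

section \<open>Infinitely often correct guesses\<close>

lemma frequently_sequentially_iff:
  "(\<exists>\<^sub>F n in sequentially. P n) \<longleftrightarrow> (\<forall>N. \<exists>n\<ge>N. P n)"
  by (simp add: frequently_def eventually_sequentially)

text \<open>A crude bound above all codes of pairs \<open>(m, j)\<close> with
  \<open>j < slalom_width m\<close>. It depends on \<open>m\<close> only, so \<open>h\<close> can be
  built from it before any null set is given.\<close>

definition guess_bound :: "nat \<Rightarrow> nat" where
  "guess_bound m = (\<Sum>j<slalom_width m. Suc (prod_encode (m, j)))"

text \<open>The slaloms for all \<open>m\<close> are enumerated and merged into one sequence by the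
  pairing function, so a captured value has an index bounded in terms of \<open>h k\<close>.\<close>

lemma null_guess_sequence:
  assumes "lebesgue_null N"
  shows "\<exists>q. \<forall>h. strict_mono h \<longrightarrow> eventually_off h \<subseteq> N \<longrightarrow>
    (\<exists>\<^sub>F k in sequentially. \<exists>n<guess_bound (h k). h (Suc k) = q n)"
proof -
  obtain U where U: "open U" "N \<subseteq> U" "U \<in> sets coin_space" "measure coin_space U < 1/2"
    by (rule null_open_superset[OF assms, of "1/2"]) simp
  then have K: "- U \<in> sets coin_space"
    using sets.compl_sets[OF U(3)] by (simp add: Compl_eq_Diff_UNIV)
  have "\<exists>e. slalom (- U) m \<subseteq> e ` {..<slalom_width m}" for m
  proof -
    obtain e where "bij_betw e {0..<card (slalom (- U) m)} (slalom (- U) m)"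
      using ex_bij_betw_nat_finite[OF finite_slalom[OF K]] by blast
    then have "slalom (- U) m = e ` {0..<card (slalom (- U) m)}"
      by (simp add: bij_betw_imp_surj_on)
    also have "\<dots> \<subseteq> e ` {..<slalom_width m}"
      using card_slalom[OF K, of m] by (intro image_mono) auto
    finally have "slalom (- U) m \<subseteq> e ` {..<slalom_width m}" .
    then show ?thesis by (rule exI[of _ e])
  qed
  then obtain e where e: "\<And>m. slalom (- U) m \<subseteq> e m ` {..<slalom_width m}"
    using choice[of "\<lambda>m e. slalom (- U) m \<subseteq> e ` {..<slalom_width m}"] by blast
  show ?thesis
  proof (intro exI[of _ "\<lambda>n. case_prod e (prod_decode n)"] allI impI)
    fix h assume h: "strict_mono h" "eventually_off h \<subseteq> N"
    have "\<exists>\<^sub>F k in sequentially. h (Suc k) \<in> slalom (- U) (h k)"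
      using h U by (intro slalom_captures) auto
    then show "\<exists>\<^sub>F k in sequentially.
        \<exists>n<guess_bound (h k). h (Suc k) = case_prod e (prod_decode n)"
    proof (rule frequently_elim1)
      fix k assume "h (Suc k) \<in> slalom (- U) (h k)"
      then obtain j where j: "j < slalom_width (h k)" "h (Suc k) = e (h k) j"
        using e by blast
      have "Suc (prod_encode (h k, j)) \<le> guess_bound (h k)"
        unfolding guess_bound_def
        using member_le_sum[of j "{..<slalom_width (h k)}" "\<lambda>j. Suc (prod_encode (h k, j))"] j(1)
        by simp
      with j(2) show "\<exists>n<guess_bound (h k). h (Suc k) = case_prod e (prod_decode n)"
        by (intro exI[of _ "prod_encode (h k, j)"]) auto
    qed
  qed
qed

text \<open>Before step \<open>n\<close> at most \<open>n\<close> values are taken, so more than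
  \<open>n\<close> candidates leave a new one. An infinite \<open>D n\<close> has
  \<open>card\<close> 0 and imposes no condition.\<close>

lemma greedy_choice:
  fixes D :: "nat \<Rightarrow> 'a set"
  shows "\<exists>p. \<forall>n. n < card (D n) \<longrightarrow> p n \<in> D n \<and> (\<forall>n'<n. p n' \<noteq> p n)"
proof (rule dependent_wellorder_choice)
  fix n :: nat and p :: "nat \<Rightarrow> 'a"
  have "\<exists>r. r \<in> D n \<and> r \<notin> p ` {..<n}" if "n < card (D n)"
  proof (rule ccontr)
    assume "\<not> ?thesis"
    then have "card (D n) \<le> card (p ` {..<n})"
      by (intro card_mono) auto
    also have "\<dots> \<le> n"
      using card_image_le[of "{..<n}" p] by simp
    finally show False using that by simp
  qed
  then show "\<exists>r. n < card (D n) \<longrightarrow> r \<in> D n \<and> (\<forall>n'<n. p n' \<noteq> r)"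
    by blast
qed auto

text \<open>Along \<open>h i\<close> longer and longer finite parts of the graph of \<open>g i\<close> on \<open>X i\<close> are coded. A captured
  value is then a guess for so many arguments that one of them is not taken by another guess.\<close>

lemma infinitely_often_guess:
  fixes g :: "'i \<Rightarrow> nat \<Rightarrow> nat"
  assumes null: "\<And>h. (\<And>i. i \<in> I \<Longrightarrow> strict_mono (h i)) \<Longrightarrow>
      lebesgue_null (\<Union>i\<in>I. eventually_off (h i))"
    and inf: "\<And>i. i \<in> I \<Longrightarrow> infinite (X i)"
  shows "\<exists>G. \<forall>i\<in>I. \<exists>\<^sub>F x in sequentially. x \<in> X i \<and> G x = g i x"
proof -
  have "\<exists>F. F \<subseteq> X i \<inter> {m..} \<and> finite F \<and> card F = guess_bound m" if "i \<in> I" for i m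
  proof -
    have "X i - {..<m} = X i \<inter> {m..}"
      by auto
    then have "infinite (X i \<inter> {m..})"
      using Diff_infinite_finite[OF _ inf[OF that], of "{..<m}"] by simp
    from infinite_arbitrarily_large[OF this, of "guess_bound m"] show ?thesis
      by blast
  qed
  then have "\<forall>i m. \<exists>F. i \<in> I \<longrightarrow> F \<subseteq> X i \<inter> {m..} \<and> finite F \<and> card F = guess_bound m"
    by blast
  then obtain F where F: "i \<in> I \<Longrightarrow> F i m \<subseteq> X i \<inter> {m..}"
    "i \<in> I \<Longrightarrow> finite (F i m)" "i \<in> I \<Longrightarrow> card (F i m) = guess_bound m" for i m
    unfolding choice_iff by blast
  define L where "L i m = map (\<lambda>x. (x, g i x)) (sorted_list_of_set (F i m))" for i m
  \<comment> \<open>The next value codes the part of the graph chosen for \<open>m\<close>; pairing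
    the code with \<open>Suc m\<close> keeps \<open>h i\<close> strictly increasing.\<close>
  define h where "h i = rec_nat 0 (\<lambda>_ m. prod_encode (to_nat (L i m), Suc m))" for i
  have h_Suc: "h i (Suc k) = prod_encode (to_nat (L i (h i k)), Suc (h i k))" for i k
    by (simp add: h_def)
  have mono: "strict_mono (h i)" for i
    unfolding strict_mono_Suc_iff h_Suc Suc_le_eq[symmetric] by (simp add: le_prod_encode_2)
  obtain q where q: "\<forall>h'. strict_mono h' \<longrightarrow> eventually_off h' \<subseteq> (\<Union>i\<in>I. eventually_off (h i)) \<longrightarrow>
      (\<exists>\<^sub>F k in sequentially. \<exists>n<guess_bound (h' k). h' (Suc k) = q n)"
    using null_guess_sequence[OF null[of h, OF mono]] ..
  define Q where "Q n = (from_nat (fst (prod_decode (q n))) :: (nat \<times> nat) list)" for n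
  define D where "D n = fst ` set (Q n)" for n
  obtain p where "\<forall>n. n < card (D n) \<longrightarrow> p n \<in> D n \<and> (\<forall>n'<n. p n' \<noteq> p n)"
    using greedy_choice ..
  then have p: "p n \<in> D n" "n' < n \<Longrightarrow> p n' \<noteq> p n" if "n < card (D n)" for n n'
    using that by auto
  \<comment> \<open>The guess that reserved the argument \<open>x\<close> decides
    \<open>G x\<close>. That guess is unique by the choice of \<open>p\<close>; arguments never
    reserved get an arbitrary value.\<close>
  define G where "G x = the (map_of (Q (SOME n. n < card (D n) \<and> p n = x)) x)" for x
  have G: "G (p n) = the (map_of (Q n) (p n))" if n: "n < card (D n)" for n
  proof -
    have "(SOME n'. n' < card (D n') \<and> p n' = p n) = n"
    proof (rule some_equality)
      fix n' assume "n' < card (D n') \<and> p n' = p n"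
      then show "n' = n"
        using p(2)[of n n'] p(2)[of n' n] n by (cases n n' rule: linorder_cases) auto
    qed (use n in simp)
    then show ?thesis by (simp add: G_def)
  qed
  show ?thesis
  proof (intro exI[of _ G] ballI)
    fix i assume i: "i \<in> I"
    show "\<exists>\<^sub>F x in sequentially. x \<in> X i \<and> G x = g i x"
      unfolding frequently_sequentially_iff
    proof
      fix N
      have "\<exists>\<^sub>F k in sequentially. \<exists>n<guess_bound (h i k). h i (Suc k) = q n"
        by (rule q[rule_format, OF mono]) (use i in blast)
      then obtain k n where k: "k \<ge> N" "n < guess_bound (h i k)" "h i (Suc k) = q n"
        unfolding frequently_sequentially_iff by blast
      have Q: "Q n = L i (h i k)"
        unfolding Q_def k(3)[symmetric] h_Suc by simp
      then have D: "D n = F i (h i k)"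
        using F(2)[OF i] by (simp add: D_def L_def image_image)
      \<comment> \<open>The part of the graph has \<open>guess_bound (h i k)\<close> arguments, more
        than the index \<open>n\<close> of the guess, so \<open>p n\<close> is one of them.\<close>
      then have n: "n < card (D n)"
        using k(2) F(3)[OF i] by simp
      have pn: "p n \<in> F i (h i k)"
        using p(1)[OF n] D by simp
      have "G (p n) = g i (p n)"
        using G[OF n] pn F(2)[OF i] by (simp add: Q L_def map_of_map_restrict)
      moreover have "p n \<in> X i" "h i k \<le> p n"
        using F(1)[OF i] pn by auto
      moreover have "N \<le> h i k"
        using k(1) strict_mono_imp_increasing[OF mono, of k i] by simp
      ultimately show "\<exists>x\<ge>N. x \<in> X i \<and> G x = g i x"
        by (intro exI[of _ "p n"]) auto
    qed
  qed
qed

section \<open>Nowhere dense and meager sets described by finite patterns\<close>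

lemma open_prefix: "open {v :: nat \<Rightarrow> bool. \<forall>i<m. v i = w i}"
  unfolding open_cantor_iff by (intro ballI exI[of _ m]) simp

text \<open>An open set that misses \<open>A\<close> also misses its closure, so finite prefixes
  suffice as a test.\<close>

lemma nowhere_dense_cantor_iff:
  fixes A :: "(nat \<Rightarrow> bool) set"
  shows "nowhere_dense A \<longleftrightarrow>
    (\<forall>w m. \<exists>w' m'. (\<forall>i<m. w' i = w i) \<and> (\<forall>v. (\<forall>i<m'. v i = w' i) \<longrightarrow> v \<notin> A))"
    (is "_ \<longleftrightarrow> ?R")
proof
  assume nd: "nowhere_dense A"
  show ?R
  proof (intro allI)
    fix w :: "nat \<Rightarrow> bool" and m :: nat
    let ?V = "{v. \<forall>i<m. v i = w i}"
    have "\<not> ?V \<subseteq> closure A"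
    proof
      assume "?V \<subseteq> closure A"
      then have "?V \<subseteq> {}"
        using interior_maximal[OF _ open_prefix] nd unfolding nowhere_dense_def by blast
      then show False by auto
    qed
    then obtain w' where w': "\<forall>i<m. w' i = w i" "w' \<in> - closure A"
      by auto
    have "\<exists>m'. \<forall>v. (\<forall>i<m'. v i = w' i) \<longrightarrow> v \<in> - closure A"
      using open_cantor_iff[THEN iffD1, rule_format, OF open_Compl[OF closed_closure] w'(2)] .
    then obtain m' where "\<forall>v. (\<forall>i<m'. v i = w' i) \<longrightarrow> v \<in> - closure A"
      by blast
    then have "\<forall>v. (\<forall>i<m'. v i = w' i) \<longrightarrow> v \<notin> A"
      using closure_subset[of A] by auto
    with w'(1) show "\<exists>w' m'. (\<forall>i<m. w' i = w i) \<and> (\<forall>v. (\<forall>i<m'. v i = w' i) \<longrightarrow> v \<notin> A)"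
      by (intro exI conjI)
  qed
next
  assume R: ?R
  show "nowhere_dense A"
    unfolding nowhere_dense_def
  proof (rule ccontr)
    assume "interior (closure A) \<noteq> {}"
    then obtain w where "w \<in> interior (closure A)"
      by blast
    then have "\<exists>m. \<forall>v. (\<forall>i<m. v i = w i) \<longrightarrow> v \<in> interior (closure A)"
      using open_cantor_iff[THEN iffD1, rule_format, OF open_interior] by blast
    then obtain m where m: "\<forall>v. (\<forall>i<m. v i = w i) \<longrightarrow> v \<in> interior (closure A)" ..
    obtain w' m' where w': "\<forall>i<m. w' i = w i" "\<forall>v. (\<forall>i<m'. v i = w' i) \<longrightarrow> v \<notin> A"
      using spec[OF spec[OF R, of w], of m] by (elim exE conjE)
    have "{v. \<forall>i<m'. v i = w' i} \<inter> A = {}"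
      using w'(2) by auto
    then have "{v. \<forall>i<m'. v i = w' i} \<inter> closure A = {}"
      by (simp add: open_Int_closure_eq_empty[OF open_prefix])
    moreover have "w' \<in> interior (closure A)"
      using m w'(1) by simp
    then have "w' \<in> closure A"
      using interior_subset by (rule set_mp[rotated])
    ultimately show False
      by auto
  qed
qed

text \<open>Only finitely many pairs of a prefix and an index \<open>j\<close> matter; one block is
  prolonged for each pair in turn until it works behind every prefix.\<close>

lemma nowhere_dense_Union_escape:
  assumes "\<And>j. nowhere_dense (N j :: (nat \<Rightarrow> bool) set)"
  shows "\<exists>e t. \<forall>y. (\<forall>i\<in>{n..<e}. y i = t i) \<longrightarrow> (\<forall>j\<le>n. y \<notin> N j)"
proof -
  have "\<exists>e t. \<forall>r\<in>R. \<forall>y. (\<forall>i<n. y i = fst r i) \<longrightarrow> (\<forall>i\<in>{n..<e}. y i = t i) \<longrightarrow> y \<notin> N (snd r)"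
    if "finite R" for R :: "((nat \<Rightarrow> bool) \<times> nat) set"
    using that
  proof induction
    case (insert r R)
    obtain e t where et: "\<forall>r\<in>R. \<forall>y. (\<forall>i<n. y i = fst r i) \<longrightarrow>
        (\<forall>i\<in>{n..<e}. y i = t i) \<longrightarrow> y \<notin> N (snd r)"
      using insert.IH by blast
    \<comment> \<open>The block \<open>t\<close> is put behind the prefix \<open>fst r\<close> and
      prolonged to avoid \<open>N (snd r)\<close>; as \<open>t\<close> is kept up to
      \<open>e\<close>, earlier requirements survive.\<close>
    obtain w' m' where w': "\<forall>i<max n e. w' i = (if i < n then fst r i else t i)"
      "\<forall>v. (\<forall>i<m'. v i = w' i) \<longrightarrow> v \<notin> N (snd r)"
      using assms[of "snd r", unfolded nowhere_dense_cantor_iff, THEN spec,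
          of "\<lambda>i. if i < n then fst r i else t i", THEN spec, of "max n e"]
      by (elim exE conjE)
    have "y \<notin> N (snd r')"
      if r': "r' \<in> insert r R" and y: "\<forall>i<n. y i = fst r' i" "\<forall>i\<in>{n..<max e m'}. y i = w' i"
      for r' y
    proof (cases "r' = r")
      case True
      have "\<forall>i<m'. y i = w' i"
      proof (intro allI impI)
        fix i assume "i < m'"
        then show "y i = w' i"
          using y w'(1) True by (cases "i < n") auto
      qed
      with w'(2) True show ?thesis by simp
    next
      case False
      have "\<forall>i\<in>{n..<e}. y i = t i"
        using y(2) w'(1) by auto
      with et r' False y(1) show ?thesis by simp
    qed
    then have "\<forall>r'\<in>insert r R. \<forall>y. (\<forall>i<n. y i = fst r' i) \<longrightarrow>
        (\<forall>i\<in>{n..<max e m'}. y i = w' i) \<longrightarrow> y \<notin> N (snd r')"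
      by simp
    then show ?case
      by (intro exI)
  qed simp
  then obtain e t where et: "\<forall>r\<in>truncs n \<times> {..n}. \<forall>y. (\<forall>i<n. y i = fst r i) \<longrightarrow>
      (\<forall>i\<in>{n..<e}. y i = t i) \<longrightarrow> y \<notin> N (snd r)"
    using finite_truncs[of n] by (metis finite_SigmaI finite_atMost)
  have "y \<notin> N j" if "\<forall>i\<in>{n..<e}. y i = t i" "j \<le> n" for y j
  proof -
    have "(trunc n y, j) \<in> truncs n \<times> {..n}" "\<forall>i<n. y i = trunc n y i"
      using that by (auto simp: truncs_def trunc_def)
    with bspec[OF et this(1)] that(1) show ?thesis
      by simp
  qed
  then show ?thesis
    by blast
qed

text \<open>A match at a single \<open>n >= j\<close> avoids \<open>N j\<close>, so infinitely many
  matches avoid the whole union.\<close>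

lemma meager_escape:
  assumes "meager (M :: (nat \<Rightarrow> bool) set)"
  shows "\<exists>e t. \<forall>y. (\<exists>\<^sub>F n in sequentially. \<forall>i\<in>{n..<e n}. y i = t n i) \<longrightarrow> y \<notin> M"
proof -
  from assms obtain N :: "nat \<Rightarrow> (nat \<Rightarrow> bool) set" where "(\<forall>n. nowhere_dense (N n)) \<and> M = (\<Union>n. N n)"
    unfolding meager_def ..
  then have N: "\<forall>n. nowhere_dense (N n)" "M = (\<Union>n. N n)"
    by simp_all
  have "\<forall>n. \<exists>e t. \<forall>y. (\<forall>i\<in>{n..<e}. y i = t i) \<longrightarrow> (\<forall>j\<le>n. y \<notin> N j)"
    by (intro allI nowhere_dense_Union_escape N(1)[rule_format])
  then obtain e t where et: "\<forall>n y. (\<forall>i\<in>{n..<e n}. y i = t n i) \<longrightarrow> (\<forall>j\<le>n. y \<notin> N j)"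
    unfolding choice_iff by (elim exE that)
  have "y \<notin> M" if frq: "\<exists>\<^sub>F n in sequentially. \<forall>i\<in>{n..<e n}. y i = t n i" for y
  proof -
    have "y \<notin> N j" for j
    proof -
      obtain n where "j \<le> n" "\<forall>i\<in>{n..<e n}. y i = t n i"
        using frq unfolding frequently_sequentially_iff by auto
      with et show ?thesis by simp
    qed
    then show ?thesis
      by (simp add: N(2))
  qed
  then show ?thesis
    by (intro exI allI impI)
qed

section \<open>Covers by meager sets\<close>

text \<open>For fixed \<open>i\<close>, the points coding a function that differs from
  \<open>g i\<close> almost everywhere form a meager set. Fewer than cov(M) such sets leave some
  point uncovered, and it codes \<open>G\<close>.\<close>

lemma infinitely_often_equal:
  fixes g :: "'i \<Rightarrow> nat \<Rightarrow> nat"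
  assumes min: "\<And>F. meager_cover F \<Longrightarrow> |C :: 'c set| \<le>o |F|" and small: "|I| <o |C|"
  shows "\<exists>G. \<forall>i\<in>I. \<exists>\<^sub>F k in sequentially. G k = g i k"
proof -
  \<comment> \<open>Row \<open>k\<close> of \<open>c\<close> is read as the position of its first
    \<open>True\<close>; a row without one gets an arbitrary value.\<close>
  define dec where "dec c k = (LEAST n. c (prod_encode (k, n)))" for c :: "nat \<Rightarrow> bool" and k
  define N where "N i m = {c. \<forall>k\<ge>m. dec c k \<noteq> g i k}" for i m
  have nd: "nowhere_dense (N i m)" for i m
    unfolding nowhere_dense_cantor_iff
  proof (intro allI)
    fix w :: "nat \<Rightarrow> bool" and M :: nat
    \<comment> \<open>Row \<open>k\<close> uses only coordinates from \<open>k\<close> on, so the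
      prefix of length \<open>M\<close> leaves it free.\<close>
    define k where "k = max m M"
    define w' where "w' j = (if j < M then w j else j = prod_encode (k, g i k))" for j
    obtain m' where m': "(\<lambda>n. prod_encode (k, n)) ` {..g i k} \<subseteq> {..<m'}"
      using finite_nat_bounded[of "(\<lambda>n. prod_encode (k, n)) ` {..g i k}"] by auto
    have "v \<notin> N i m" if v: "\<forall>j<m'. v j = w' j" for v
    proof -
      have "v (prod_encode (k, n)) \<longleftrightarrow> n = g i k" if n: "n \<le> g i k" for n
      proof -
        have "prod_encode (k, n) < m'"
          using m' n by auto
        moreover have "M \<le> prod_encode (k, n)"
          using le_prod_encode_1[of k n] by (simp add: k_def)
        ultimately show ?thesis
          using v by (simp add: w'_def)
      qed
      then have "dec v k = g i k"
        unfolding dec_def by (intro Least_equality) (auto intro: leI)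
      then show ?thesis
        unfolding N_def k_def using max.cobounded1[of m M] by blast
    qed
    moreover have "\<forall>j<M. w' j = w j"
      by (simp add: w'_def)
    ultimately show "\<exists>w' m'. (\<forall>j<M. w' j = w j) \<and> (\<forall>v. (\<forall>j<m'. v j = w' j) \<longrightarrow> v \<notin> N i m)"
      by blast
  qed
  define F where "F = (\<lambda>i. \<Union>m. N i m) ` I"
  have "meager (\<Union>m. N i m)" for i
    unfolding meager_def using nd by blast
  moreover have "|F| <o |C|"
    unfolding F_def by (rule ordLeq_ordLess_trans[OF card_of_image small])
  then have "\<not> meager_cover F"
    using min not_ordLess_ordLeq by blast
  ultimately have "\<Union>F \<noteq> UNIV"
    by (auto simp: meager_cover_def F_def)
  then obtain c where c: "c \<notin> \<Union>F"
    by auto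
  have "\<exists>\<^sub>F k in sequentially. dec c k = g i k" if "i \<in> I" for i
    using c that unfolding frequently_sequentially_iff F_def N_def by auto
  then show ?thesis
    by (intro exI[of _ "dec c"]) auto
qed

text \<open>\<open>G\<close> guesses the values of \<open>h i\<close> on \<open>{k..<2 * k}\<close>
  for infinitely many \<open>k\<close>. A point eventually off \<open>h i\<close> then vanishes on
  infinitely many of the guessed sets, and Borel-Cantelli applies.\<close>

lemma lebesgue_null_UN_eventually_off:
  fixes h :: "'i \<Rightarrow> nat \<Rightarrow> nat"
  assumes min: "\<And>F. meager_cover F \<Longrightarrow> |C :: 'c set| \<le>o |F|" and small: "|I| <o |C|"
    and mono: "\<And>i. i \<in> I \<Longrightarrow> strict_mono (h i)"
  shows "lebesgue_null (\<Union>i\<in>I. eventually_off (h i))"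
proof -
  obtain G where G: "\<forall>i\<in>I. \<exists>\<^sub>F k in sequentially. G k = set_encode (h i ` {k..<2 * k})"
    using infinitely_often_equal[OF min small, of "\<lambda>i k. set_encode (h i ` {k..<2 * k})"] by auto
  \<comment> \<open>Guesses of the wrong size are discarded, so \<open>A k\<close> has measure at
    most \<open>(1/2) ^ k\<close> for any \<open>G\<close>.\<close>
  define A where "A k = (if card (set_decode (G k)) = k then
    {w. \<forall>q\<in>set_decode (G k). w q = False} else {})" for k
  have sets: "A k \<in> sets coin_space" for k
    unfolding A_def using sets_coin_prescribed[of "set_decode (G k)" "\<lambda>_. False"] by simp
  have le: "measure coin_space (A k) \<le> (1/2) ^ k" for k
    using measure_coin_prescribed[of "set_decode (G k)" "\<lambda>_. False"] by (simp add: A_def)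
  have "summable (\<lambda>k. measure coin_space (A k))"
  proof (rule summable_comparison_test')
    show "summable (\<lambda>k. (1/2 :: real) ^ k)"
      by (rule summable_geometric) simp
  qed (simp add: le)
  then have null: "limsup A \<in> null_sets coin_space"
    using sets by (intro borel_cantelli_limsup1) (auto simp: coin.emeasure_eq_measure)
  have "eventually_off (h i) \<subseteq> limsup A" if i: "i \<in> I" for i
  proof
    fix w assume "w \<in> eventually_off (h i)"
    then obtain n0 where n0: "\<And>n. n \<ge> n0 \<Longrightarrow> \<not> w (h i n)"
      by (auto simp: eventually_off_def eventually_sequentially)
    have "\<exists>k\<ge>n. w \<in> A k" for n
    proof -
      obtain k where k: "k \<ge> max n n0" "G k = set_encode (h i ` {k..<2 * k})"
        using G i unfolding frequently_sequentially_iff by blast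
      then have dec: "set_decode (G k) = h i ` {k..<2 * k}"
        by simp
      have "inj_on (h i) {k..<2 * k}"
        using mono[OF i] strict_mono_imp_inj_on inj_on_subset by blast
      then have "card (set_decode (G k)) = k"
        unfolding dec by (simp add: card_image)
      then have "w \<in> A k"
        using n0 k(1) by (auto simp: A_def dec)
      then show ?thesis
        using k(1) by auto
    qed
    then show "w \<in> limsup A"
      by (simp add: limsup_INF_SUP) (meson atLeast_iff)
  qed
  then show ?thesis
    unfolding lebesgue_null_iff using null by blast
qed

text \<open>Otherwise \<open>infinitely_often_guess\<close> applies to families indexed by
  \<open>C\<close>; two uses of it build a point matching the patterns from
  \<open>meager_escape\<close> infinitely often for every \<open>M\<close> in
  \<open>C\<close>.\<close>

lemma cover_not_all_null:
  assumes cover: "meager_cover C"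
  shows "\<exists>h. (\<forall>M\<in>C. strict_mono (h M)) \<and> \<not> lebesgue_null (\<Union>M\<in>C. eventually_off (h M))"
proof (rule ccontr)
  assume "\<not> ?thesis"
  then have null: "lebesgue_null (\<Union>M\<in>C. eventually_off (h M))"
    if "\<And>M. M \<in> C \<Longrightarrow> strict_mono (h M)" for h
    using that by blast
  have "\<forall>M\<in>C. \<exists>e t. \<forall>y. (\<exists>\<^sub>F n in sequentially. \<forall>i\<in>{n..<e n}. y i = t n i) \<longrightarrow> y \<notin> M"
    using cover meager_escape by (auto simp: meager_cover_def)
  then obtain e t where et: "\<forall>M\<in>C. \<forall>y.
      (\<exists>\<^sub>F n in sequentially. \<forall>i\<in>{n..<e M n}. y i = t M n i) \<longrightarrow> y \<notin> M"
    unfolding bchoice_iff by (elim exE that)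
  define f where "f M n = Suc n + (\<Sum>i\<le>n. e M i)" for M n
  have f_ge: "e M n \<le> f M n" for M n
    using member_le_sum[of n "{..n}" "e M"] by (simp add: f_def)
  have f_mono: "f M n \<le> f M n'" if "n \<le> n'" for M n n'
    unfolding f_def using that by (intro add_mono sum_mono2) auto
  \<comment> \<open>The first guess \<open>G\<close> yields blocks \<open>[j k, j (k + 1))\<close>; the second guess \<open>H\<close> fills them.\<close>
  obtain G where G: "\<forall>M\<in>C. \<exists>\<^sub>F n in sequentially. n \<in> UNIV \<and> G n = f M (f M n)"
    using infinitely_often_guess[OF null, where X = "\<lambda>_. UNIV" and g = "\<lambda>M n. f M (f M n)"] by auto
  define j where "j = rec_nat 0 (\<lambda>_ a. Suc a + (\<Sum>i\<le>a. G i))"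
  have j_0: "j 0 = 0" and j_Suc: "j (Suc k) = Suc (j k) + (\<Sum>i\<le>j k. G i)" for k
    by (simp_all add: j_def)
  have j_mono: "strict_mono j"
    unfolding strict_mono_Suc_iff by (simp add: j_Suc)
  have G_le: "G n \<le> j (Suc k)" if "n \<le> j k" for n k
    using member_le_sum[of n "{..j k}" G] that by (simp add: j_Suc)
  \<comment> \<open>The intervals long enough to hold the block \<open>[j k, e M (j k))\<close>
    prescribed for \<open>M\<close>.\<close>
  define X where "X M = {k. f M (j k) \<le> j (Suc k)}" for M
  have inf: "infinite (X M)" if M: "M \<in> C" for M
    unfolding infinite_nat_iff_unbounded_le
  proof
    fix K
    obtain n where n: "n \<ge> j K" "G n = f M (f M n)"
      using G M unfolding frequently_sequentially_iff by auto
    define k where "k = (LEAST k. n < j (Suc k))"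
    have "n < j (Suc n)"
      using strict_mono_imp_increasing[OF j_mono, of "Suc n"] by simp
    then have k_less: "n < j (Suc k)"
      unfolding k_def by (rule LeastI)
    have k_ge: "j k \<le> n"
    proof (cases k)
      case (Suc k')
      then have "\<not> n < j (Suc k')"
        using not_less_Least[of k' "\<lambda>k. n < j (Suc k)"] by (simp add: k_def)
      then show ?thesis using Suc by simp
    qed (simp add: j_0)
    have "j K < j (Suc k)"
      using n(1) k_less by simp
    then have "K \<le> k"
      using strict_mono_less[OF j_mono] by simp
    have bound: "f M (f M n) \<le> j (Suc (Suc k))"
      using G_le[of n "Suc k"] k_less n(2) by simp
    \<comment> \<open>Here the iterate of \<open>f M\<close> pays off: either \<open>f M n\<close>
      stays below the end of the interval of \<open>n\<close>, or the next interval is long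
      enough.\<close>
    show "\<exists>k'\<ge>K. k' \<in> X M"
    proof (cases "f M n \<le> j (Suc k)")
      case True
      then have "k \<in> X M"
        using f_mono[OF k_ge, of M] by (simp add: X_def)
      with \<open>K \<le> k\<close> show ?thesis by blast
    next
      case False
      then have "Suc k \<in> X M"
        using f_mono[of "j (Suc k)" "f M n" M] bound by (simp add: X_def)
      with \<open>K \<le> k\<close> show ?thesis by (intro exI[of _ "Suc k"]) simp
    qed
  qed
  \<comment> \<open>Listing from 0 lets \<open>y\<close> use the coordinate itself as list
    index.\<close>
  define g where "g M k = to_nat (map (t M (j k)) [0..<j (Suc k)])" for M k
  obtain H where H: "\<forall>M\<in>C. \<exists>\<^sub>F k in sequentially. k \<in> X M \<and> H k = g M k"
    using infinitely_often_guess[of C X g, OF null inf] by auto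
  define block where "block i = (LEAST k. i < j (Suc k))" for i
  have block: "block i = k" if "j k \<le> i" "i < j (Suc k)" for i k
    unfolding block_def
  proof (rule Least_equality)
    fix k' assume "i < j (Suc k')"
    then have "j k < j (Suc k')"
      using that(1) by simp
    then show "k \<le> k'"
      using strict_mono_less[OF j_mono] by simp
  qed (rule that(2))
  define y where "y i = (from_nat (H (block i)) :: bool list) ! i" for i
  have "y \<notin> M" if M: "M \<in> C" for M
  proof -
    have "\<exists>\<^sub>F n in sequentially. \<forall>i\<in>{n..<e M n}. y i = t M n i"
      unfolding frequently_sequentially_iff
    proof
      fix N
      obtain k where k: "k \<ge> N" "k \<in> X M" "H k = g M k"
        using H M unfolding frequently_sequentially_iff by blast
      have "e M (j k) \<le> j (Suc k)"
        using f_ge[of M "j k"] k(2) by (simp add: X_def)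
      then have "\<forall>i\<in>{j k..<e M (j k)}. y i = t M (j k) i"
        by (auto simp: y_def block k(3) g_def)
      moreover have "N \<le> j k"
        using strict_mono_imp_increasing[OF j_mono, of k] k(1) by simp
      ultimately show "\<exists>n\<ge>N. \<forall>i\<in>{n..<e M n}. y i = t M n i"
        by blast
    qed
    with et M show ?thesis by blast
  qed
  then have "y \<notin> \<Union>C"
    by blast
  moreover have "\<Union>C = UNIV"
    using cover by (simp add: meager_cover_def)
  ultimately show False
    by simp
qed

section \<open>Equality of the two cardinals contradicts \<open>GP_all\<close>\<close>

theorem theorem5p1:
  assumes "GP_all"
  shows "\<not> cov_meager =o bounding_number"
proof
  assume eq: "cov_meager =o bounding_number"
  obtain C where C: "meager_cover C" "cov_meager = |C|" "\<And>F. meager_cover F \<Longrightarrow> |C| \<le>o |F|"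
    using least_card_eq[of meager_cover, OF meager_cover_exists] by (auto simp: cov_meager_def)
  obtain B where B: "unbounded_family B" "bounding_number = |B|"
    "\<And>F. unbounded_family F \<Longrightarrow> |B| \<le>o |F|"
    using least_card_eq[of unbounded_family, OF unbounded_family_UNIV]
    by (auto simp: bounding_number_def)
  have CB: "|C| =o |B|"
    using eq C(2) B(2) by simp
  then obtain f where f: "bij_betw f C B"
    using card_of_ordIso by blast
  obtain h where h: "\<And>M. M \<in> C \<Longrightarrow> strict_mono (h M)"
    "\<not> lebesgue_null (\<Union>M\<in>C. eventually_off (h M))"
    using cover_not_all_null[OF C(1)] by blast
  \<comment> \<open>The cover is indexed by \<open>B\<close> through \<open>f\<close>. The relation
    \<open>|B|\<close> is a well-order of \<open>B\<close> whose proper initial segments are all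
    smaller than \<open>B\<close>.\<close>
  define I where "I x = {M \<in> C. \<forall>b. (b, f M) \<in> |B| \<longrightarrow> b \<le>\<^sup>* x}" for x
  have ord: "refl_on B |B|" "total_on B |B|"
    using card_of_well_order_on[of B]
    by (simp_all add: well_order_on_def linear_order_on_def partial_order_on_def preorder_on_def)
  have small_I: "|I x| <o |C|" for x
  proof -
    \<comment> \<open>As \<open>x\<close> fails to dominate \<open>b0\<close>, the map
      \<open>f\<close> sends \<open>I x\<close> into the strict predecessors of
      \<open>b0\<close>.\<close>
    obtain b0 where b0: "b0 \<in> B" "\<not> b0 \<le>\<^sup>* x"
      using B(1) by (auto simp: unbounded_family_def)
    have "f M \<in> underS |B| b0" if M: "M \<in> I x" for M
    proof -
      have fM: "f M \<in> B" "(b0, f M) \<notin> |B|"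
        using M b0(2) f by (auto simp: I_def bij_betw_def)
      then have "f M \<noteq> b0"
        using refl_onD[OF ord(1) b0(1)] by auto
      moreover from this have "(f M, b0) \<in> |B|"
        using fM b0(1) ord(2) unfolding total_on_def by blast
      ultimately show ?thesis
        by (simp add: underS_def)
    qed
    moreover have "inj_on f (I x)"
      using f by (auto simp: I_def bij_betw_def intro: inj_on_subset)
    ultimately have "|I x| \<le>o |underS |B| b0|"
      by (intro card_of_ordLeqI)
    also have "|underS |B| b0| <o |B|"
      using b0(1) by (intro card_of_underS card_of_Card_order) (simp add: Field_card_of)
    finally show ?thesis
      using CB ordIso_symmetric ordLess_ordIso_trans by blast
  qed
  have "lebesgue_null (\<Union>M\<in>I x. eventually_off (h M))" for x
    by (rule lebesgue_null_UN_eventually_off[OF C(3) small_I]) (use h in \<open>auto simp: I_def\<close>)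
  moreover have "I x \<subseteq> I x'" if "x \<le> x'" for x x'
  proof -
    have "b \<le>\<^sup>* x'" if "b \<le>\<^sup>* x" for b
      using that \<open>x \<le> x'\<close> unfolding eventually_le_def le_fun_def
      by (auto elim!: eventually_mono intro: order.trans)
    then show ?thesis
      by (auto simp: I_def)
  qed
  then have "\<forall>x x'. x \<le> x' \<longrightarrow> (\<Union>M\<in>I x. eventually_off (h M)) \<subseteq> (\<Union>M\<in>I x'. eventually_off (h M))"
    by blast
  ultimately have "lebesgue_null (\<Union>x. \<Union>M\<in>I x. eventually_off (h M))"
    using assms[unfolded GP_all_def, rule_format, of "\<lambda>x. \<Union>M\<in>I x. eventually_off (h M)"] by simp
  \<comment> \<open>By minimality of \<open>B\<close>, the strict predecessors of \<open>f M\<close>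
    have a common bound; its maximum with \<open>f M\<close> puts \<open>M\<close> into some
    \<open>I x'\<close>.\<close>
  moreover have "M \<in> (\<Union>x. I x)" if M: "M \<in> C" for M
  proof -
    have fM: "f M \<in> B"
      using f M by (auto simp: bij_betw_def)
    then have "|underS |B| (f M)| <o |B|"
      by (intro card_of_underS card_of_Card_order) (simp add: Field_card_of)
    then have "\<not> unbounded_family (underS |B| (f M))"
      using B(3) not_ordLess_ordLeq by blast
    then obtain x where x: "\<And>b. b \<in> underS |B| (f M) \<Longrightarrow> b \<le>\<^sup>* x"
      by (auto simp: unbounded_family_def)
    define x' where "x' n = max (x n) (f M n)" for n
    have "b \<le>\<^sup>* x'" if "(b, f M) \<in> |B|" for b
    proof (cases "b = f M")
      case True
      then show ?thesis by (simp add: eventually_le_def x'_def)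
    next
      case False
      then have "b \<le>\<^sup>* x"
        using x that by (simp add: underS_def)
      then show ?thesis
        unfolding eventually_le_def x'_def by (auto elim!: eventually_mono)
    qed
    then show ?thesis
      using M by (auto simp: I_def)
  qed
  then have "(\<Union>M\<in>C. eventually_off (h M)) \<subseteq> (\<Union>x. \<Union>M\<in>I x. eventually_off (h M))"
    by blast
  ultimately show False
    using h(2) lebesgue_null_subset by blast
qed

end
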